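(* Let $P$ be a $\mathrm{TN}$-poset with quasi-rank function $\rho$, and let $S$ be a set of nonnegative integers. Then the induced subposet $P_S=\{x\in P:\rho(x)\in S\}$ is a $\mathrm{TN}$-poset.
   Context: Let $P$ be a locally finite poset such that $\rho(x)=\max\{k: x_0<x_1<\cdots<x_k=x,\ x_i\in P\}$ is finite for every $x\in P$; $\rho$ is the quasi-rank function of $P$, and $\rho(P)=\sup_{x\in P}\rho(x)\in\mathbb{N}\cup\{\infty\}$. Write $\langle x\rangle=\{z\in P:z\le x\}$. $P$ is quasi-rank uniform if for all $x,y\in P$ with $\rho(x)=\rho(y)$ one has $|\{z\in\langle x\rangle:\rho(z)=k\}|=|\{z\in\langle y\rangle:\rho(z)=k\}|$ (finite) for all $0\le k\le\rho(x)$. Then put $r_{n,k}=|\{z\in\langle x\rangle:\rho(z)=k\}|$ for any $x$ with $\rho(x)=n$, and $R(P)=(r_{n,k})_{n,k=0}^{N}$, $N=\rho(P)$ (a lower triangular matrix with unit diagonal). A quasi-rank uniform poset $P$ is a $\mathrm{TN}$-poset if $R(P)$ is totally nonnegative, i.e. all its minors are nonnegative. The notions for $P_S$ are taken with respect to the quasi-rank function of the poset $P_S$ itself. *)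

theory Defs
  imports Main "HOL-Library.Extended_Nat" "Jordan_Normal_Form.Determinant"
begin

text \<open>A poset is a set \<open>P\<close> in an ordered type, with the order induced from that type; thus an
  induced subposet is just a subset. Every notion below is relative to \<open>P\<close>, so that applied to a
  subset \<open>Q\<close> of \<open>P\<close> it only refers to chains and elements of \<open>Q\<close>.\<close>

definition locally_finite_poset :: "'a::order set \<Rightarrow> bool" where
  "locally_finite_poset P \<longleftrightarrow> (\<forall>x\<in>P. \<forall>y\<in>P. finite {z \<in> P. x \<le> z \<and> z \<le> y})"

definition chain_lengths :: "'a::order set \<Rightarrow> 'a \<Rightarrow> nat set" where
  "chain_lengths P x =
     {k. \<exists>c :: nat \<Rightarrow> 'a. c ` {..k} \<subseteq> P \<and> strict_mono_on {..k} c \<and> c k = x}"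

text \<open>Meaningful when the set of chain lengths is finite, which is required separately
  in \<open>has_quasi_rank\<close>.\<close>

definition quasi_rank :: "'a::order set \<Rightarrow> 'a \<Rightarrow> nat" where
  "quasi_rank P x = Max (chain_lengths P x)"

definition has_quasi_rank :: "'a::order set \<Rightarrow> bool" where
  "has_quasi_rank P \<longleftrightarrow> locally_finite_poset P \<and> (\<forall>x\<in>P. finite (chain_lengths P x))"

definition poset_rank :: "'a::order set \<Rightarrow> enat" where
  "poset_rank P = (SUP x\<in>P. enat (quasi_rank P x))"

definition principal_ideal :: "'a::order set \<Rightarrow> 'a \<Rightarrow> 'a set" where
  "principal_ideal P x = {z \<in> P. z \<le> x}"

definition ideal_level :: "'a::order set \<Rightarrow> 'a \<Rightarrow> nat \<Rightarrow> 'a set" where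
  "ideal_level P x k = {z \<in> principal_ideal P x. quasi_rank P z = k}"

definition quasi_rank_uniform :: "'a::order set \<Rightarrow> bool" where
  "quasi_rank_uniform P \<longleftrightarrow>
     has_quasi_rank P \<and>
     (\<forall>x\<in>P. \<forall>y\<in>P. quasi_rank P x = quasi_rank P y \<longrightarrow>
        (\<forall>k\<le>quasi_rank P x.
           finite (ideal_level P x k) \<and> finite (ideal_level P y k) \<and>
           card (ideal_level P x k) = card (ideal_level P y k)))"

text \<open>The entry \<open>r\<^sub>n\<^sub>,\<^sub>k\<close>; independent of the choice of \<open>x\<close> when \<open>P\<close> is quasi-rank uniform.\<close>

definition rank_matrix :: "'a::order set \<Rightarrow> nat \<Rightarrow> nat \<Rightarrow> real" where
  "rank_matrix P n k = real (card (ideal_level P (SOME x. x \<in> P \<and> quasi_rank P x = n) k))"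

text \<open>Total nonnegativity of the possibly infinite matrix \<open>(A n k)\<close> with \<open>0 \<le> n, k \<le> N\<close>:
  \<open>f\<close> and \<open>g\<close> enumerate the rows and columns of an \<open>m \<times> m\<close> minor in increasing order.\<close>

definition totally_nonnegative :: "enat \<Rightarrow> (nat \<Rightarrow> nat \<Rightarrow> real) \<Rightarrow> bool" where
  "totally_nonnegative N A \<longleftrightarrow>
     (\<forall>m (f :: nat \<Rightarrow> nat) (g :: nat \<Rightarrow> nat).
        strict_mono_on {..<m} f \<longrightarrow> strict_mono_on {..<m} g \<longrightarrow>
        (\<forall>i<m. enat (f i) \<le> N \<and> enat (g i) \<le> N) \<longrightarrow>
        0 \<le> det (mat m m (\<lambda>(i, j). A (f i) (g j))))"

text \<open>For the empty poset \<open>poset_rank\<close> is \<open>0\<close> and the matrix is the \<open>1 \<times> 1\<close> zero matrix, so the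
  empty poset is a TN-poset.\<close>

definition TN_poset :: "'a::order set \<Rightarrow> bool" where
  "TN_poset P \<longleftrightarrow> quasi_rank_uniform P \<and> totally_nonnegative (poset_rank P) (rank_matrix P)"

definition rank_selected :: "'a::order set \<Rightarrow> nat set \<Rightarrow> 'a set" where
  "rank_selected P S = {x \<in> P. quasi_rank P x \<in> S}"

end

theory Submission
  imports Defs
begin

text \<open>A longest chain below \<open>x\<close> meets every quasi-rank up to that of \<open>x\<close>, so deleting the elements
  with quasi-rank outside \<open>S\<close> leaves a chain through all elements of \<open>S\<close> up to that quasi-rank.
  Hence the quasi-rank of \<open>x\<close> in \<open>P\<^sub>S\<close> is the position of its old quasi-rank in \<open>S\<close>, and
  the matrix of \<open>P\<^sub>S\<close> is the submatrix of the matrix of \<open>P\<close> with rows and columns in \<open>S\<close>.\<close>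

section \<open>Chains and their lengths\<close>

lemma zero_mem_chain_lengths: "x \<in> P \<Longrightarrow> 0 \<in> chain_lengths P x"
  by (auto simp: chain_lengths_def intro!: exI[of _ "\<lambda>_. x"] strict_mono_onI)

lemma chain_lengths_extend:
  assumes "k \<in> chain_lengths P z" "z < x" "x \<in> P"
  shows "Suc k \<in> chain_lengths P x"
proof -
  obtain c :: "nat \<Rightarrow> 'a" where c: "c ` {..k} \<subseteq> P" "strict_mono_on {..k} c" "c k = z"
    using assms(1) by (auto simp: chain_lengths_def)
  have le: "c i \<le> z" if "i \<le> k" for i
    using c(2,3) that by (metis atMost_iff le_less strict_mono_onD)
  \<comment> \<open>A chain of length \<open>k\<close> has the \<open>k + 1\<close> indices
    \<open>0..k\<close>, so the new top goes to index \<open>Suc k\<close>.\<close>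
  let ?d = "c(Suc k := x)"
  have "?d ` {..Suc k} \<subseteq> P"
    using c(1) assms(3) by (auto simp: le_Suc_eq)
  moreover have "strict_mono_on {..Suc k} ?d"
  proof (rule strict_mono_onI)
    fix i j assume ij: "i \<in> {..Suc k}" "j \<in> {..Suc k}" "i < j"
    show "?d i < ?d j"
    proof (cases "j = Suc k")
      case True
      with ij le[of i] assms(2) show ?thesis by auto
    next
      case False
      with ij strict_mono_onD[OF c(2), of i j] show ?thesis by auto
    qed
  qed
  moreover have "?d (Suc k) = x" by simp
  ultimately show ?thesis unfolding chain_lengths_def by blast
qed

lemma chain_lengths_SucD:
  assumes "Suc k \<in> chain_lengths P x"
  shows "\<exists>z\<in>P. z < x \<and> k \<in> chain_lengths P z"
proof -
  obtain c :: "nat \<Rightarrow> 'a"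
    where c: "c ` {..Suc k} \<subseteq> P" "strict_mono_on {..Suc k} c" "c (Suc k) = x"
    using assms by (auto simp: chain_lengths_def)
  have "c k < x" using strict_mono_onD[OF c(2), of k "Suc k"] c(3) by simp
  moreover have "c k \<in> P" using c(1) by auto
  moreover have "c ` {..k} \<subseteq> P" using c(1) by auto
  moreover have "strict_mono_on {..k} c" using c(2) by (rule monotone_on_subset) auto
  ultimately show ?thesis unfolding chain_lengths_def by blast
qed

lemma chain_lengths_mono: "Q \<subseteq> P \<Longrightarrow> chain_lengths Q x \<subseteq> chain_lengths P x"
  unfolding chain_lengths_def by blast

section \<open>Elementary properties of the quasi-rank\<close>

context
  fixes P :: "'a::order set"
  assumes hq: "has_quasi_rank P"
begin

lemma le_quasi_rank: "x \<in> P \<Longrightarrow> k \<in> chain_lengths P x \<Longrightarrow> k \<le> quasi_rank P x"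
  using hq by (auto simp: quasi_rank_def has_quasi_rank_def)

lemma quasi_rank_mem: "x \<in> P \<Longrightarrow> quasi_rank P x \<in> chain_lengths P x"
  unfolding quasi_rank_def using hq zero_mem_chain_lengths[of x P]
  by (intro Max_in) (auto simp: has_quasi_rank_def)

text \<open>A longest chain ending in \<open>x\<close> is prolonged by \<open>y\<close>.\<close>

lemma quasi_rank_less: "x \<in> P \<Longrightarrow> y \<in> P \<Longrightarrow> x < y \<Longrightarrow> quasi_rank P x < quasi_rank P y"
  using le_quasi_rank[OF _ chain_lengths_extend[OF quasi_rank_mem]] by (simp add: Suc_le_eq)

lemma quasi_rank_le: "x \<in> P \<Longrightarrow> y \<in> P \<Longrightarrow> x \<le> y \<Longrightarrow> quasi_rank P x \<le> quasi_rank P y"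
  using quasi_rank_less by (auto simp: le_less)

text \<open>Removing the top of a longest chain leaves an element of quasi-rank exactly one less:
  the shortened chain bounds it from below, \<open>quasi_rank_less\<close> from above. Descending in
  this way skips no value.\<close>

lemma exists_quasi_rank_below:
  assumes "x \<in> P" "k < quasi_rank P x"
  shows "\<exists>z\<in>P. z < x \<and> quasi_rank P z = k"
  using assms
proof (induction "quasi_rank P x" arbitrary: x)
  case 0
  then show ?case by simp
next
  case (Suc n)
  then obtain z where z: "z \<in> P" "z < x" "n \<in> chain_lengths P z"
    using quasi_rank_mem[of x] chain_lengths_SucD by metis
  have n: "quasi_rank P z = n"
    using quasi_rank_less[of z x] le_quasi_rank[of z n] z Suc by simp
  show ?case
  proof (cases "k = n")
    case True
    with z n show ?thesis by blast
  next
    case False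
    then obtain w where "w \<in> P" "w < z" "quasi_rank P w = k"
      using Suc n z by (metis less_SucE)
    with z show ?thesis using less_trans by blast
  qed
qed

lemma exists_quasi_rank_eq:
  assumes "P \<noteq> {}" "enat n \<le> poset_rank P"
  shows "\<exists>x\<in>P. quasi_rank P x = n"
proof -
  have "\<exists>x\<in>P. n \<le> quasi_rank P x"
  proof (rule ccontr)
    assume no: "\<not> ?thesis"
    \<comment> \<open>An element of \<open>P\<close> rules out \<open>n = 0\<close>, so
      \<open>n - 1\<close> is a genuine predecessor and bounds every quasi-rank.\<close>
    then have n: "n > 0" using assms(1) by auto
    have "poset_rank P \<le> enat (n - 1)"
      unfolding poset_rank_def using no by (auto intro!: SUP_least)
    with assms(2) have "enat n \<le> enat (n - 1)" by (rule order_trans)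
    with n show False by simp
  qed
  then show ?thesis using exists_quasi_rank_below by (metis le_less)
qed

lemma quasi_rank_le_poset_rank: "x \<in> P \<Longrightarrow> enat (quasi_rank P x) \<le> poset_rank P"
  unfolding poset_rank_def by (rule SUP_upper)

lemma ideal_level_eq_empty: "x \<in> P \<Longrightarrow> quasi_rank P x < k \<Longrightarrow> ideal_level P x k = {}"
  using quasi_rank_le by (fastforce simp: ideal_level_def principal_ideal_def)

section \<open>Quasi-rank and levels of the rank-selected subposet\<close>

lemma rank_selected_subset: "rank_selected P S \<subseteq> P"
  by (auto simp: rank_selected_def)

lemma has_quasi_rank_rank_selected: "has_quasi_rank (rank_selected P S)"
proof -
  let ?Q = "rank_selected P S"
  have "finite {z \<in> ?Q. x \<le> z \<and> z \<le> y}" if "x \<in> ?Q" "y \<in> ?Q" for x y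
    by (rule finite_subset[of _ "{z \<in> P. x \<le> z \<and> z \<le> y}"])
      (use that hq rank_selected_subset[of S] in
        \<open>auto simp: has_quasi_rank_def locally_finite_poset_def\<close>)
  moreover have "finite (chain_lengths ?Q x)" if "x \<in> ?Q" for x
    by (rule finite_subset[OF chain_lengths_mono[OF rank_selected_subset]])
      (use that hq rank_selected_subset[of S] in \<open>auto simp: has_quasi_rank_def\<close>)
  ultimately show ?thesis
    by (auto simp: has_quasi_rank_def locally_finite_poset_def)
qed

text \<open>This is the lower bound for the new quasi-rank. Take the largest \<open>m\<close> in
  \<open>S\<close> below the old quasi-rank of \<open>x\<close> and an element \<open>z < x\<close>
  of quasi-rank \<open>m\<close>. It survives the selection, and \<open>x\<close> prolongs its chain
  by one, just as \<open>m\<close> adds one to the count.\<close>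

lemma card_mem_chain_lengths_rank_selected:
  assumes "x \<in> rank_selected P S"
  shows "card (S \<inter> {..<quasi_rank P x}) \<in> chain_lengths (rank_selected P S) x"
  using assms
proof (induction "quasi_rank P x" arbitrary: x rule: less_induct)
  case less
  let ?A = "S \<inter> {..<quasi_rank P x}"
  have xP: "x \<in> P" using less by (simp add: rank_selected_def)
  show ?case
  proof (cases "?A = {}")
    case True
    with less show ?thesis by (metis zero_mem_chain_lengths card.empty)
  next
    case False
    define m where "m = Max ?A"
    have m: "m \<in> S" "m < quasi_rank P x" and ub: "\<And>i. i \<in> ?A \<Longrightarrow> i \<le> m"
      using Max_in[of ?A] False by (auto simp: m_def)
    obtain z where z: "z \<in> P" "z < x" "quasi_rank P z = m"
      using exists_quasi_rank_below[OF xP m(2)] by blast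
    with m less(1)[of z] have "card (S \<inter> {..<m}) \<in> chain_lengths (rank_selected P S) z"
      by (simp add: rank_selected_def)
    then have "Suc (card (S \<inter> {..<m})) \<in> chain_lengths (rank_selected P S) x"
      using z less by (blast intro: chain_lengths_extend)
    moreover have "?A = insert m (S \<inter> {..<m})"
    proof
      show "?A \<subseteq> insert m (S \<inter> {..<m})" using ub by (fastforce simp: le_less)
      show "insert m (S \<inter> {..<m}) \<subseteq> ?A" using m by auto
    qed
    ultimately show ?thesis by simp
  qed
qed

text \<open>The preceding lemma attains the count. It is also an upper bound, since the members of a
  chain strictly below \<open>x\<close> have distinct old quasi-ranks, all in \<open>S\<close> and
  below that of \<open>x\<close>.\<close>

lemma quasi_rank_rank_selected:
  assumes x: "x \<in> rank_selected P S"
  shows "quasi_rank (rank_selected P S) x = card (S \<inter> {..<quasi_rank P x})"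
proof -
  have "k \<le> card (S \<inter> {..<quasi_rank P x})" if k: "k \<in> chain_lengths (rank_selected P S) x" for k
  proof -
    obtain c :: "nat \<Rightarrow> 'a"
      where c: "c ` {..k} \<subseteq> rank_selected P S" "strict_mono_on {..k} c" "c k = x"
      using k by (auto simp: chain_lengths_def)
    have cP: "c i \<in> P" if "i \<le> k" for i
      using c(1) that rank_selected_subset[of S] by blast
    have less: "quasi_rank P (c i) < quasi_rank P (c j)" if "i < j" "j \<le> k" for i j
      using strict_mono_onD[OF c(2), of i j] that by (intro quasi_rank_less cP) auto
    \<comment> \<open>Index \<open>k\<close> is left out because it carries \<open>x\<close> itself;
      the \<open>k\<close> members below it are counted.\<close>
    have "inj_on (\<lambda>i. quasi_rank P (c i)) {..<k}"
      by (intro strict_mono_on_imp_inj_on strict_mono_onI) (use less in auto)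
    moreover have "(\<lambda>i. quasi_rank P (c i)) ` {..<k} \<subseteq> S \<inter> {..<quasi_rank P x}"
    proof
      fix q
      assume "q \<in> (\<lambda>i. quasi_rank P (c i)) ` {..<k}"
      then obtain i where i: "i < k" "q = quasi_rank P (c i)" by auto
      then have "c i \<in> rank_selected P S" using c(1) by auto
      with i less[of i k] c(3) show "q \<in> S \<inter> {..<quasi_rank P x}"
        by (simp add: rank_selected_def)
    qed
    ultimately have "card {..<k} \<le> card (S \<inter> {..<quasi_rank P x})"
      by (rule card_inj_on_le) simp
    then show ?thesis by simp
  qed
  moreover have "finite (chain_lengths (rank_selected P S) x)"
    using has_quasi_rank_rank_selected[of S] x by (simp add: has_quasi_rank_def)
  ultimately have "Max (chain_lengths (rank_selected P S) x) = card (S \<inter> {..<quasi_rank P x})"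
    using card_mem_chain_lengths_rank_selected[OF x] by (intro Max_eqI)
  then show ?thesis by (simp only: quasi_rank_def[of "rank_selected P S"])
qed

lemma quasi_rank_rank_selected_less:
  assumes "x \<in> rank_selected P S" "y \<in> rank_selected P S" "quasi_rank P x < quasi_rank P y"
  shows "quasi_rank (rank_selected P S) x < quasi_rank (rank_selected P S) y"
proof -
  \<comment> \<open>The inclusion is strict because \<open>quasi_rank P x\<close> itself lies in
    \<open>S\<close>.\<close>
  have "S \<inter> {..<quasi_rank P x} \<subset> S \<inter> {..<quasi_rank P y}"
    using assms by (auto simp: rank_selected_def)
  then show ?thesis
    using assms by (simp add: quasi_rank_rank_selected psubset_card_mono)
qed

lemma quasi_rank_rank_selected_less_iff:
  assumes "x \<in> rank_selected P S" "y \<in> rank_selected P S"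
  shows "quasi_rank (rank_selected P S) x < quasi_rank (rank_selected P S) y \<longleftrightarrow>
    quasi_rank P x < quasi_rank P y"
  using assms quasi_rank_rank_selected_less[of x S y] quasi_rank_rank_selected_less[of y S x]
    quasi_rank_rank_selected[of x S] quasi_rank_rank_selected[of y S]
  by (metis less_asym' linorder_neqE_nat)

lemma quasi_rank_rank_selected_eq_iff:
  assumes "x \<in> rank_selected P S" "y \<in> rank_selected P S"
  shows "quasi_rank (rank_selected P S) x = quasi_rank (rank_selected P S) y \<longleftrightarrow>
    quasi_rank P x = quasi_rank P y"
  using quasi_rank_rank_selected_less_iff[OF assms]
    quasi_rank_rank_selected_less_iff[OF assms(2,1)]
  by (metis linorder_neqE_nat less_irrefl)

text \<open>Selection keeps or removes a level as a whole: the old quasi-rank of \<open>w\<close> is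
  in \<open>S\<close>, so all elements sharing it survive. A surviving level only changes its
  index.\<close>

lemma ideal_level_rank_selected:
  assumes "w \<in> rank_selected P S"
  shows "ideal_level (rank_selected P S) x (quasi_rank (rank_selected P S) w) =
    ideal_level P x (quasi_rank P w)"
  using quasi_rank_rank_selected_eq_iff[OF _ assms] assms
  by (auto simp: ideal_level_def principal_ideal_def rank_selected_def)

end

section \<open>Uniformity and matrix entries\<close>

text \<open>Uniformity covers \<open>k\<close> up to the diagonal; beyond it both levels are
  empty.\<close>

lemma card_ideal_level_eq:
  assumes "quasi_rank_uniform P" "x \<in> P" "y \<in> P" "quasi_rank P x = quasi_rank P y"
  shows "card (ideal_level P x k) = card (ideal_level P y k)"
proof (cases "k \<le> quasi_rank P x")
  case True
  with assms show ?thesis unfolding quasi_rank_uniform_def by blast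
next
  case False
  have "has_quasi_rank P" using assms(1) by (simp add: quasi_rank_uniform_def)
  note empty = ideal_level_eq_empty[OF this]
  show ?thesis using empty[OF assms(2), of k] empty[OF assms(3), of k] assms(4) False by simp
qed

lemma rank_matrix_eq:
  assumes "quasi_rank_uniform P" "x \<in> P"
  shows "rank_matrix P (quasi_rank P x) k = real (card (ideal_level P x k))"
proof -
  let ?y = "SOME y. y \<in> P \<and> quasi_rank P y = quasi_rank P x"
  have "?y \<in> P \<and> quasi_rank P ?y = quasi_rank P x"
    by (rule someI[of _ x]) (use assms in simp)
  then show ?thesis
    using card_ideal_level_eq[OF assms(1) _ assms(2)] by (simp add: rank_matrix_def)
qed

lemma quasi_rank_uniform_rank_selected:
  assumes "quasi_rank_uniform P"
  shows "quasi_rank_uniform (rank_selected P S)"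
  unfolding quasi_rank_uniform_def
proof (intro conjI ballI allI impI)
  let ?Q = "rank_selected P S"
  have hq: "has_quasi_rank P" using assms by (simp add: quasi_rank_uniform_def)
  then show hQ: "has_quasi_rank ?Q" by (rule has_quasi_rank_rank_selected)
  fix x y k
  assume x: "x \<in> ?Q" and y: "y \<in> ?Q" and eq: "quasi_rank ?Q x = quasi_rank ?Q y"
    and k: "k \<le> quasi_rank ?Q x"
  \<comment> \<open>The element \<open>w\<close> translates the new index \<open>k\<close> into an
    old one. Taking it below \<open>x\<close> puts the old index within the range of uniformity of
    \<open>P\<close>.\<close>
  obtain w where w: "w \<in> ?Q" "quasi_rank ?Q w = k" "w \<le> x"
    using exists_quasi_rank_below[OF hQ x] x k by (metis le_less)
  have P: "x \<in> P" "y \<in> P" "w \<in> P"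
    using x y w by (auto simp: rank_selected_def)
  have eqP: "quasi_rank P x = quasi_rank P y"
    using quasi_rank_rank_selected_eq_iff[OF hq x y] eq by simp
  have le: "quasi_rank P w \<le> quasi_rank P x"
    using quasi_rank_le[OF hq] P w by blast
  have level: "ideal_level ?Q v k = ideal_level P v (quasi_rank P w)" for v
    using ideal_level_rank_selected[OF hq w(1)] w(2) by simp
  show "finite (ideal_level ?Q x k)" "finite (ideal_level ?Q y k)"
    "card (ideal_level ?Q x k) = card (ideal_level ?Q y k)"
    using assms P eqP le unfolding level quasi_rank_uniform_def by blast+
qed

section \<open>Total nonnegativity\<close>

lemma TN_poset_empty: "TN_poset {}"
proof -
  have "0 \<le> det (mat m m (\<lambda>(i, j). rank_matrix {} (f i) (g j)))"
    if f: "strict_mono_on {..<m} f" and le: "\<forall>i<m. enat (f i) \<le> 0" for m and f g :: "nat \<Rightarrow> nat"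
  proof -
    \<comment> \<open>Only index 0 is available, so a strictly increasing \<open>f\<close> has at
      most one argument.\<close>
    have "\<not> 1 < m"
    proof
      assume "1 < m"
      then show False
        using strict_mono_onD[OF f, of 0 1] le by (auto simp: zero_enat_def)
    qed
    then consider "m = 0" | "m = 1" by linarith
    then show ?thesis
      by cases (auto simp: det_single rank_matrix_def)
  qed
  then show ?thesis
    by (auto simp: TN_poset_def quasi_rank_uniform_def has_quasi_rank_def poset_rank_def
        locally_finite_poset_def totally_nonnegative_def bot_enat_def)
qed

theorem proposition5p9:
  fixes P :: "'a::order set" and S :: "nat set"
  assumes "TN_poset P"
  shows "TN_poset (rank_selected P S)"
proof (cases "rank_selected P S = {}")
  case True
  then show ?thesis by (simp add: TN_poset_empty)
next
  case False
  let ?Q = "rank_selected P S"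
  have un: "quasi_rank_uniform P" and tn: "totally_nonnegative (poset_rank P) (rank_matrix P)"
    using assms by (auto simp: TN_poset_def)
  have hq: "has_quasi_rank P" using un by (simp add: quasi_rank_uniform_def)
  note unQ = quasi_rank_uniform_rank_selected[OF un, of S]
  have hQ: "has_quasi_rank ?Q" using unQ by (simp add: quasi_rank_uniform_def)
  \<comment> \<open>The implication stands inside the quantifier so that choice gives a total
    function; its values beyond \<open>poset_rank ?Q\<close> are arbitrary.\<close>
  have "\<exists>x. enat n \<le> poset_rank ?Q \<longrightarrow> x \<in> ?Q \<and> quasi_rank ?Q x = n" for n
    using exists_quasi_rank_eq[OF hQ False] by blast
  then obtain y where y: "\<And>n. enat n \<le> poset_rank ?Q \<Longrightarrow> y n \<in> ?Q \<and> quasi_rank ?Q (y n) = n"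
    by metis
  \<comment> \<open>On indices up to \<open>poset_rank ?Q\<close>, \<open>s\<close> lists in
    increasing order the elements of \<open>S\<close> that occur as quasi-ranks in
    \<open>P\<close>.\<close>
  define s where "s n = quasi_rank P (y n)" for n
  have s_less: "s k < s n" if "enat k \<le> poset_rank ?Q" "enat n \<le> poset_rank ?Q" "k < n" for k n
    using quasi_rank_rank_selected_less_iff[OF hq, of "y k" S "y n"] y that by (simp add: s_def)
  have s_le: "enat (s n) \<le> poset_rank P" if "enat n \<le> poset_rank ?Q" for n
    using quasi_rank_le_poset_rank[OF hq] y[OF that] by (simp add: s_def rank_selected_def)
  have entry: "rank_matrix ?Q n k = rank_matrix P (s n) (s k)"
    if n: "enat n \<le> poset_rank ?Q" and k: "enat k \<le> poset_rank ?Q" for n k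
  proof -
    \<comment> \<open>The same element \<open>y n\<close> represents row \<open>n\<close> of the new
      matrix and row \<open>s n\<close> of the old one.\<close>
    have "rank_matrix ?Q n k = real (card (ideal_level ?Q (y n) k))"
      using rank_matrix_eq[OF unQ, of "y n"] y[OF n] by simp
    also have "ideal_level ?Q (y n) k = ideal_level P (y n) (s k)"
      using ideal_level_rank_selected[OF hq, of "y k" S] y[OF k] by (simp add: s_def)
    finally show ?thesis
      using rank_matrix_eq[OF un, of "y n"] y[OF n] by (simp add: s_def rank_selected_def)
  qed
  have "totally_nonnegative (poset_rank ?Q) (rank_matrix ?Q)"
    unfolding totally_nonnegative_def
  proof (intro allI impI)
    fix m and f g :: "nat \<Rightarrow> nat"
    assume f: "strict_mono_on {..<m} f" and g: "strict_mono_on {..<m} g"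
      and le: "\<forall>i<m. enat (f i) \<le> poset_rank ?Q \<and> enat (g i) \<le> poset_rank ?Q"
    \<comment> \<open>Composition with \<open>s\<close> turns the minor of the new matrix given by
      \<open>f\<close> and \<open>g\<close> into a minor of the old one.\<close>
    have "strict_mono_on {..<m} (s \<circ> f)" "strict_mono_on {..<m} (s \<circ> g)"
      using f g le s_less by (auto intro!: strict_mono_onI dest: strict_mono_onD)
    moreover have "\<forall>i<m. enat ((s \<circ> f) i) \<le> poset_rank P \<and> enat ((s \<circ> g) i) \<le> poset_rank P"
      using le s_le by simp
    ultimately have "0 \<le> det (mat m m (\<lambda>(i, j). rank_matrix P ((s \<circ> f) i) ((s \<circ> g) j)))"
      using tn unfolding totally_nonnegative_def by blast
    also have "mat m m (\<lambda>(i, j). rank_matrix P ((s \<circ> f) i) ((s \<circ> g) j)) =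
        mat m m (\<lambda>(i, j). rank_matrix ?Q (f i) (g j))"
      using le entry by (intro cong_mat) auto
    finally show "0 \<le> det (mat m m (\<lambda>(i, j). rank_matrix ?Q (f i) (g j)))" .
  qed
  with unQ show ?thesis by (simp add: TN_poset_def)
qed

end
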